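(* Let $\mathcal{A}$ be a nonempty indecomposable real central arrangement in $\mathbb{R}^\ell$ and let $m$ be a positive integer. Then: (1) if $|\mathcal{A}|=1$, then $AM(\mathcal{A},m)=\{\Phi:\mathbf{Ch}^m\to\mathbf{Ch}\mid \Phi(C,C,\dots,C)=C \text{ for each chamber } C\}$; (2) if $|\mathcal{A}|\ge 3$, every admissible map $\Phi:\mathbf{Ch}^m\to\mathbf{Ch}$ is projective, i.e. there is $h\in\{1,\dots,m\}$ with $\Phi(C_1,\dots,C_m)=C_h$ for all $(C_1,\dots,C_m)\in\mathbf{Ch}^m$.
   Context: A real central arrangement $\mathcal{A}=\{H_1,\dots,H_n\}$ in $\mathbb{R}^\ell$ is a finite set of linear hyperplanes; for each $H_j$ fix a real linear form $\alpha_j$ with $H_j=\ker\alpha_j$, and set $H_j^+=\{x:\alpha_j(x)>0\}$, $H_j^-=\{x:\alpha_j(x)<0\}$. The chambers are the connected components of $\mathbb{R}^\ell\setminus\bigcup_j H_j$; $\mathbf{Ch}$ is the set of chambers. Let $B=\{+,-\}$ as a multiplicative group. For $\sigma\in B$, define $\epsilon_j^\sigma:\mathbf{Ch}\to B$ by $\epsilon_j^\sigma(C)=\sigma\tau$ if $C\subseteq H_j^\tau$, extended componentwise to $\mathbf{Ch}^m\to B^m$. A map $\Phi:\mathbf{Ch}^m\to\mathbf{Ch}$ is admissible if there exist maps $\varphi_j^\sigma:B^m\to B$ ($1\le j\le n$, $\sigma\in B$) with $\varphi_j^\sigma(+,\dots,+)=+$ and $\epsilon_j^\sigma\circ\Phi=\varphi_j^\sigma\circ\epsilon_j^\sigma$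 for all $j,\sigma$; $AM(\mathcal{A},m)$ denotes the set of admissible maps. Projective admissible maps are the projections $\Phi(C_1,\dots,C_m)=C_h$ (with $\varphi_j^\sigma$ the projection to the $h$-th component). Let $r(\mathcal{A})=\operatorname{codim}\bigcap_{H\in\mathcal{A}}H$. $\mathcal{A}$ is decomposable if $\mathcal{A}$ is a disjoint union of nonempty subarrangements $\mathcal{A}_1,\mathcal{A}_2$ with $r(\mathcal{A})=r(\mathcal{A}_1)+r(\mathcal{A}_2)$, and indecomposable otherwise. *)

theory Defs
  imports "HOL-Analysis.Analysis"
begin

section \<open>The sign group\<close>

datatype sign = Plus | Minus

instantiation sign :: comm_monoid_mult
begin

definition one_sign :: sign where
  "1 = Plus"

definition times_sign :: "sign \<Rightarrow> sign \<Rightarrow> sign" where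
  "s * t = (if s = t then Plus else Minus)"

instance
proof
  fix a b c :: sign
  show "a * b * c = a * (b * c)"
    by (cases a; cases b; cases c) (simp_all add: times_sign_def)
  show "a * b = b * a"
    by (simp add: times_sign_def eq_commute)
  show "1 * a = a"
    by (cases a) (simp_all add: times_sign_def one_sign_def)
qed

end

lemma sign_mult_self: "s * s = (1 :: sign)"
  by (simp add: times_sign_def one_sign_def)


section \<open>Real central arrangements\<close>

definition linear_hyperplane :: "(real ^ 'l) set \<Rightarrow> bool" where
  "linear_hyperplane H \<longleftrightarrow> subspace H \<and> dim H + 1 = CARD('l)"

definition central_arrangement :: "(real ^ 'l) set set \<Rightarrow> bool" where
  "central_arrangement A \<longleftrightarrow> finite A \<and> (\<forall>H\<in>A. linear_hyperplane H)"

text \<open>The hyperplanes are indexed by themselves: \<open>\<alpha> H\<close> is the linear form chosen for \<open>H\<close>.\<close>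

definition defining_forms :: "(real ^ 'l) set set \<Rightarrow> ((real ^ 'l) set \<Rightarrow> real ^ 'l \<Rightarrow> real) \<Rightarrow> bool"
  where "defining_forms A \<alpha> \<longleftrightarrow> (\<forall>H\<in>A. linear (\<alpha> H) \<and> H = {x. \<alpha> H x = 0})"

fun half_space :: "(real ^ 'l \<Rightarrow> real) \<Rightarrow> sign \<Rightarrow> (real ^ 'l) set" where
  "half_space f Plus = {x. f x > 0}"
| "half_space f Minus = {x. f x < 0}"

definition chambers :: "(real ^ 'l) set set \<Rightarrow> (real ^ 'l) set set" where
  "chambers A = components (UNIV - \<Union>A)"

definition arr_rank :: "(real ^ 'l) set set \<Rightarrow> nat" where
  "arr_rank A = CARD('l) - dim (\<Inter>A)"

definition decomposable :: "(real ^ 'l) set set \<Rightarrow> bool" where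
  "decomposable A \<longleftrightarrow>
    (\<exists>A1 A2. A1 \<noteq> {} \<and> A2 \<noteq> {} \<and> A1 \<inter> A2 = {} \<and> A1 \<union> A2 = A
       \<and> arr_rank A = arr_rank A1 + arr_rank A2)"


section \<open>Admissible maps\<close>

text \<open>The power \<open>X\<^sup>m\<close> consists of the functions \<open>{1..m} \<rightarrow> X\<close>, and maps between powers are
  likewise taken in extensional form, so that set-theoretic maps are equal iff they agree on
  their domain.\<close>

definition tuples :: "nat \<Rightarrow> 'b set \<Rightarrow> (nat \<Rightarrow> 'b) set" where
  "tuples m X = {1..m} \<rightarrow>\<^sub>E X"

definition const_tuple :: "nat \<Rightarrow> 'b \<Rightarrow> nat \<Rightarrow> 'b" where
  "const_tuple m c = (\<lambda>i\<in>{1..m}. c)"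

text \<open>The description is proper on chambers: a chamber lies in exactly one of the two open
  half-spaces of each hyperplane.\<close>

definition eps :: "(real ^ 'l \<Rightarrow> real) \<Rightarrow> sign \<Rightarrow> (real ^ 'l) set \<Rightarrow> sign" where
  "eps f \<sigma> C = \<sigma> * (THE \<tau>. C \<subseteq> half_space f \<tau>)"

definition eps_tuple ::
    "nat \<Rightarrow> (real ^ 'l \<Rightarrow> real) \<Rightarrow> sign \<Rightarrow> (nat \<Rightarrow> (real ^ 'l) set) \<Rightarrow> nat \<Rightarrow> sign" where
  "eps_tuple m f \<sigma> Cs = (\<lambda>i\<in>{1..m}. eps f \<sigma> (Cs i))"

definition chamber_maps ::
    "(real ^ 'l) set set \<Rightarrow> nat \<Rightarrow> ((nat \<Rightarrow> (real ^ 'l) set) \<Rightarrow> (real ^ 'l) set) set" where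
  "chamber_maps A m = tuples m (chambers A) \<rightarrow>\<^sub>E chambers A"

text \<open>The value of \<open>\<phi> H \<sigma>\<close> only matters on \<open>tuples m UNIV\<close>, which is \<open>B\<^sup>m\<close>.\<close>

definition admissible_maps ::
    "(real ^ 'l) set set \<Rightarrow> ((real ^ 'l) set \<Rightarrow> real ^ 'l \<Rightarrow> real) \<Rightarrow> nat
      \<Rightarrow> ((nat \<Rightarrow> (real ^ 'l) set) \<Rightarrow> (real ^ 'l) set) set" where
  "admissible_maps A \<alpha> m =
    {\<Phi> \<in> chamber_maps A m.
      \<exists>\<phi> :: (real ^ 'l) set \<Rightarrow> sign \<Rightarrow> (nat \<Rightarrow> sign) \<Rightarrow> sign.
        \<forall>H\<in>A. \<forall>\<sigma>.
          \<phi> H \<sigma> (const_tuple m Plus) = Plus \<and>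
          (\<forall>Cs\<in>tuples m (chambers A). eps (\<alpha> H) \<sigma> (\<Phi> Cs) = \<phi> H \<sigma> (eps_tuple m (\<alpha> H) \<sigma> Cs))}"

definition projective ::
    "(real ^ 'l) set set \<Rightarrow> nat \<Rightarrow> ((nat \<Rightarrow> (real ^ 'l) set) \<Rightarrow> (real ^ 'l) set) \<Rightarrow> bool" where
  "projective A m \<Phi> \<longleftrightarrow> (\<exists>h\<in>{1..m}. \<forall>Cs\<in>tuples m (chambers A). \<Phi> Cs = Cs h)"

end

theory Submission
  imports Defs
begin

text \<open>
  The argument is that of Arrow's theorem, with the \<open>m\<close> chambers as voters. On a circuit of the
  arrangement, i.e. a minimal dependent set of normals with relation \<open>\<Sum>u\<^sub>H \<alpha>\<^sub>H = 0\<close>, the only sign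
  patterns not attained by a chamber are the two for which all terms \<open>u\<^sub>H \<alpha>\<^sub>H\<close> have the same sign.
  As a circuit has at least three members, this forces the sets of voters that are decisive for the
  hyperplanes of the circuit to form one common ultrafilter on \<open>{1..m}\<close>, so a single voter \<open>h\<close>
  dictates there. Every circuit meeting the set of hyperplanes dictated by \<open>h\<close> is then
  contained in it; such a set splits the rank additively from its complement, so by
  indecomposability it is all of \<open>A\<close>.
\<close>

section \<open>Decisive sets of voters as ultrafilters\<close>

text \<open>Finiteness and closure under intersection give a least member \<open>D\<close>. If
  \<open>h\<close> lies in both \<open>D\<close> and \<open>S\<close>, then \<open>V - S\<close>
  does not contain \<open>D\<close>, so the complement rule puts \<open>S\<close> into the
  family.\<close>

lemma finite_ultrafilter_principal:
  fixes V :: "'v set"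
  assumes "finite V" and "\<not> F {}"
    and compl: "\<And>S. S \<subseteq> V \<Longrightarrow> F (V - S) \<longleftrightarrow> \<not> F S"
    and inter: "\<And>S T. S \<subseteq> V \<Longrightarrow> T \<subseteq> V \<Longrightarrow> F S \<Longrightarrow> F T \<Longrightarrow> F (S \<inter> T)"
  shows "\<exists>h\<in>V. \<forall>S\<subseteq>V. F S \<longleftrightarrow> h \<in> S"
proof -
  define \<F> where "\<F> = {S. S \<subseteq> V \<and> F S}"
  have "V \<in> \<F>"
    using compl[of "{}"] assms(2) by (simp add: \<F>_def)
  moreover have "finite \<F>"
    using \<open>finite V\<close> by (simp add: \<F>_def)
  ultimately obtain D where D: "D \<in> \<F>" and min: "\<And>S. S \<in> \<F> \<Longrightarrow> S \<subseteq> D \<Longrightarrow> S = D"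
    using finite_has_minimal[of \<F>] by (metis empty_iff)
  have least: "D \<subseteq> S" if "S \<in> \<F>" for S
  proof -
    have "D \<inter> S \<in> \<F>"
      using D that inter[of D S] by (auto simp: \<F>_def)
    then show ?thesis
      using min[of "D \<inter> S"] by blast
  qed
  have "D \<noteq> {}"
    using D assms(2) unfolding \<F>_def by blast
  then obtain h where "h \<in> D"
    by blast
  moreover have "h \<in> V"
    using D \<open>h \<in> D\<close> by (auto simp: \<F>_def)
  moreover have "F S" if "S \<subseteq> V" "h \<in> S" for S
  proof (rule ccontr)
    assume "\<not> F S"
    then have "V - S \<in> \<F>"
      using compl that by (auto simp: \<F>_def)
    then show False
      using least \<open>h \<in> D\<close> that by blast
  qed
  moreover have "h \<in> S" if "S \<subseteq> V" "F S" for S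
    using least[of S] that \<open>h \<in> D\<close> by (auto simp: \<F>_def)
  ultimately show ?thesis
    by blast
qed

text \<open>Read \<open>F i S\<close> as: issue \<open>i\<close> is accepted when exactly the voters
  in \<open>S\<close> favour it. Condition \<open>mixed\<close> says that if no voter is uniform
  over all issues, neither is the outcome. Two issues suffice to make every voter mixed, which
  yields duality; a third issue makes all families equal and closed under intersection.\<close>

lemma circuit_dictator:
  fixes V :: "'v set" and F :: "'i \<Rightarrow> 'v set \<Rightarrow> bool"
  assumes "finite V" and "card I \<ge> 3"
    and full: "\<And>i. i \<in> I \<Longrightarrow> F i V" and empty: "\<And>i. i \<in> I \<Longrightarrow> \<not> F i {}"
    and mixed: "\<And>S. \<lbrakk>\<And>i. i \<in> I \<Longrightarrow> S i \<subseteq> V; \<And>v. v \<in> V \<Longrightarrow> \<exists>i\<in>I. v \<in> S i;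
        \<And>v. v \<in> V \<Longrightarrow> \<exists>i\<in>I. v \<notin> S i\<rbrakk> \<Longrightarrow> (\<exists>i\<in>I. F i (S i)) \<and> (\<exists>i\<in>I. \<not> F i (S i))"
  shows "\<exists>h\<in>V. \<forall>i\<in>I. \<forall>S\<subseteq>V. F i S \<longleftrightarrow> h \<in> S"
proof -
  have third: "\<exists>k\<in>I. k \<noteq> i \<and> k \<noteq> j" for i j
  proof (rule ccontr)
    assume "\<not> ?thesis"
    then have "I \<subseteq> {i, j}" by blast
    then have "card I \<le> card {i, j}" by (intro card_mono) auto
    also have "\<dots> \<le> 2" by (simp add: card_insert_if)
    finally show False using \<open>card I \<ge> 3\<close> by simp
  qed
  have dual: "F j (V - S) \<longleftrightarrow> \<not> F i S" if "i \<in> I" "j \<in> I" "i \<noteq> j" "S \<subseteq> V" for i j S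
  proof -
    \<comment> \<open>Complementary sets at \<open>i\<close> and \<open>j\<close> already make every
      voter mixed, so the other issues can be accepted by all (\<open>T = V\<close>) or rejected by
      all (\<open>T = {}\<close>). The dissenting outcome must then occur at \<open>i\<close> or
      \<open>j\<close>.\<close>
    let ?S = "\<lambda>T k. if k = i then S else if k = j then V - S else T"
    have *: "(\<exists>k\<in>I. F k (?S T k)) \<and> (\<exists>k\<in>I. \<not> F k (?S T k))" if "T \<subseteq> V" for T
    proof (rule mixed)
      show "?S T k \<subseteq> V" for k using that \<open>S \<subseteq> V\<close> by auto
      show "\<exists>k\<in>I. v \<in> ?S T k" if "v \<in> V" for v
        using that \<open>i \<in> I\<close> \<open>j \<in> I\<close> \<open>i \<noteq> j\<close> by (cases "v \<in> S") (auto split: if_splits)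
      show "\<exists>k\<in>I. v \<notin> ?S T k" if "v \<in> V" for v
        using that \<open>i \<in> I\<close> \<open>j \<in> I\<close> \<open>i \<noteq> j\<close> by (cases "v \<in> S") (auto split: if_splits)
    qed
    show ?thesis
      using *[of V] *[of "{}"] full empty by (auto split: if_splits)
  qed
  obtain i where "i \<in> I"
    using third by blast
  obtain j where "j \<in> I" "j \<noteq> i"
    using third by blast
  obtain k where "k \<in> I" "k \<noteq> i" "k \<noteq> j"
    using third by blast
  \<comment> \<open>By duality, both sides are the negation of \<open>F n (V - S)\<close> for an
    issue \<open>n\<close> different from \<open>i\<close> and \<open>l\<close>.\<close>
  have same: "F l S \<longleftrightarrow> F i S" if "l \<in> I" "S \<subseteq> V" for l S
  proof -
    obtain n where "n \<in> I" "n \<noteq> i" "n \<noteq> l"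
      using third by blast
    then show ?thesis
      using dual[of i n S] dual[of l n S] that \<open>i \<in> I\<close> by auto
  qed
  have compl: "F i (V - S) \<longleftrightarrow> \<not> F i S" if "S \<subseteq> V" for S
    using dual[of i j S] same[of j "V - S"] that \<open>i \<in> I\<close> \<open>j \<in> I\<close> \<open>j \<noteq> i\<close> by auto
  have "\<exists>h\<in>V. \<forall>S\<subseteq>V. F i S \<longleftrightarrow> h \<in> S"
  proof (rule finite_ultrafilter_principal)
    show "F i (S \<inter> T)" if "S \<subseteq> V" "T \<subseteq> V" "F i S" "F i T" for S T
    proof (rule ccontr)
      assume "\<not> F i (S \<inter> T)"
      then have F: "F i (V - S \<inter> T)"
        using compl[of "S \<inter> T"] that by auto
      \<comment> \<open>The sets \<open>S\<close>, \<open>T\<close> and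
        \<open>V - S \<inter> T\<close> cover \<open>V\<close> and have no common point, so every
        voter is mixed; yet every issue would be accepted.\<close>
      let ?S = "\<lambda>l. if l = i then S else if l = j then T else if l = k then V - S \<inter> T else V"
      have "\<exists>l\<in>I. \<not> F l (?S l)"
      proof (rule mixed[THEN conjunct2])
        show "?S l \<subseteq> V" for l using that by auto
        show "\<exists>l\<in>I. v \<in> ?S l" if "v \<in> V" for v
          using that \<open>i \<in> I\<close> \<open>j \<in> I\<close> \<open>j \<noteq> i\<close> \<open>k \<in> I\<close> \<open>k \<noteq> i\<close> \<open>k \<noteq> j\<close>
          by (cases "v \<in> S \<inter> T") (auto split: if_splits)
        show "\<exists>l\<in>I. v \<notin> ?S l" if "v \<in> V" for v
        proof -
          consider "v \<notin> S" | "v \<notin> T" | "v \<in> S \<inter> T" by blast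
          then show ?thesis
            using \<open>i \<in> I\<close> \<open>j \<in> I\<close> \<open>j \<noteq> i\<close> \<open>k \<in> I\<close> \<open>k \<noteq> i\<close> \<open>k \<noteq> j\<close>
            by cases (auto split: if_splits)
        qed
      qed
      then show False
        using that F full same[of _ T] same[of _ "V - S \<inter> T"] by (auto split: if_splits)
    qed
  qed (use assms compl \<open>i \<in> I\<close> in auto)
  then show ?thesis
    using same by metis
qed

section \<open>Minimal linear dependences and their sign patterns\<close>

text \<open>For linear \<open>f\<close> this is its Riesz representative, the vector whose inner
  product with \<open>x\<close> is \<open>f x\<close>.\<close>

definition normal :: "('a::euclidean_space \<Rightarrow> real) \<Rightarrow> 'a" where
  "normal f = adjoint f 1"

lemma linear_eq_inner_normal:
  assumes "linear f"
  shows "f x = normal f \<bullet> x"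
  using adjoint_works[OF assms, of x 1] by (simp add: normal_def inner_commute)

text \<open>A vanishing coefficient at \<open>v\<close> would leave a nontrivial relation on the
  proper subset \<open>C - {v}\<close>.\<close>

lemma minimal_dependent_coeffs:
  fixes C :: "'a::real_vector set"
  assumes "finite C" "dependent C" and min: "\<And>D. D \<subset> C \<Longrightarrow> independent D"
  obtains u where "\<And>v. v \<in> C \<Longrightarrow> u v \<noteq> 0" "(\<Sum>v\<in>C. u v *\<^sub>R v) = 0"
proof -
  obtain u where u: "(\<Sum>v\<in>C. u v *\<^sub>R v) = 0" "\<exists>v\<in>C. u v \<noteq> 0"
    using assms(1,2) dependent_finite by blast
  have "u v \<noteq> 0" if "v \<in> C" for v
  proof
    assume "u v = 0"
    then have "(\<Sum>v\<in>C - {v}. u v *\<^sub>R v) = 0"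
      using u(1) that \<open>finite C\<close> by (simp add: sum.remove)
    moreover have "\<exists>w\<in>C - {v}. u w \<noteq> 0"
      using u(2) \<open>u v = 0\<close> by blast
    ultimately have "dependent (C - {v})"
      using \<open>finite C\<close> dependent_finite[of "C - {v}"] by blast
    then show False
      using min that by blast
  qed
  then show thesis
    using u(1) that by blast
qed

text \<open>Values can be prescribed freely on the independent set \<open>C - {p}\<close>, and the
  relation then forces the value at \<open>p\<close>. It therefore suffices to rescale
  \<open>s\<close> by positive factors until it satisfies the relation. The witnesses
  \<open>p\<close> and \<open>q\<close> provide terms \<open>u v * s v\<close> of both signs, and
  weighting each part by the total of the other balances them.\<close>

lemma circuit_signs_realizable:
  fixes C :: "'a::euclidean_space set" and u s :: "'a \<Rightarrow> real"
  assumes "finite C" and min: "\<And>D. D \<subset> C \<Longrightarrow> independent D"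
    and rel: "(\<Sum>v\<in>C. u v *\<^sub>R v) = 0" and u: "\<And>v. v \<in> C \<Longrightarrow> u v \<noteq> 0"
    and "p \<in> C" "u p * s p > 0" and "q \<in> C" "u q * s q < 0"
    and s: "\<And>v. v \<in> C \<Longrightarrow> s v \<noteq> 0"
  shows "\<exists>x. \<forall>v\<in>C. (v \<bullet> x) * s v > 0"
proof -
  define P N where "P = {v \<in> C. u v * s v > 0}" and "N = {v \<in> C. u v * s v < 0}"
  define a b where "a = (\<Sum>v\<in>P. u v * s v)" and "b = - (\<Sum>v\<in>N. u v * s v)"
  define y where "y v = (if v \<in> P then s v * b else s v * a)" for v
  have C: "C = P \<union> N" "P \<inter> N = {}" "finite P" "finite N"
    using u s \<open>finite C\<close> unfolding P_def N_def
    by (auto simp: zero_less_mult_iff mult_less_0_iff neq_iff)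
  have "P \<noteq> {}" "N \<noteq> {}"
    using assms unfolding P_def N_def by blast+
  have "a > 0"
    unfolding a_def using C(3) \<open>P \<noteq> {}\<close> by (intro sum_pos) (auto simp: P_def)
  moreover have "b > 0"
    unfolding b_def sum_negf[symmetric] using C(4) \<open>N \<noteq> {}\<close> by (intro sum_pos) (auto simp: N_def)
  ultimately have ys: "y v * s v > 0" if "v \<in> C" for v
    using s[OF that] by (auto simp: y_def zero_less_mult_iff mult_less_0_iff)
  \<comment> \<open>\<open>y\<close> has the signs of \<open>s\<close>, rescaled so that it satisfies the linear relation.\<close>
  have "(\<Sum>v\<in>P. u v * y v) = b * a"
    unfolding a_def sum_distrib_left by (intro sum.cong) (auto simp: y_def)
  moreover have "(\<Sum>v\<in>N. u v * y v) = a * - b"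
    unfolding b_def minus_minus sum_distrib_left
    using C(2) by (intro sum.cong) (auto simp: y_def)
  ultimately have uy: "(\<Sum>v\<in>C. u v * y v) = 0"
    using C by (simp add: sum.union_disjoint)
  have "independent (C - {p})"
    using min \<open>p \<in> C\<close> by blast
  then obtain f where "linear f" and f: "\<And>v. v \<in> C - {p} \<Longrightarrow> f v = y v"
    using linear_independent_extend[of "C - {p}" y] by blast
  let ?x = "normal f"
  have x: "v \<bullet> ?x = f v" for v
    using linear_eq_inner_normal[OF \<open>linear f\<close>] by (simp add: inner_commute)
  have "(\<Sum>v\<in>C. u v * f v) = (\<Sum>v\<in>C. u v *\<^sub>R v) \<bullet> ?x"
    unfolding inner_sum_left inner_scaleR_left unfolding x ..
  then have "(\<Sum>v\<in>C. u v * f v) = (\<Sum>v\<in>C. u v * y v)"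
    using rel uy by simp
  then have "u p * f p = u p * y p"
    using f \<open>finite C\<close> \<open>p \<in> C\<close> by (simp add: sum.remove[of C p])
  then have "f v = y v" if "v \<in> C" for v
    using f that u[OF \<open>p \<in> C\<close>] by (cases "v = p") auto
  then show ?thesis
    using ys x by (intro exI[of _ ?x]) simp
qed

text \<open>The union of a basis of \<open>X\<close> and a basis of \<open>Y\<close> is independent:
  a minimal dependent subset would lie in \<open>X\<close> or in \<open>Y\<close>, hence by
  disjointness inside one of the two bases.\<close>

lemma dim_union_of_circuit_separation:
  fixes X Y :: "'a::euclidean_space set"
  assumes "finite X" "finite Y" "X \<inter> Y = {}"
    and sep: "\<And>C. \<lbrakk>C \<subseteq> X \<union> Y; dependent C; \<And>D. D \<subset> C \<Longrightarrow> independent D\<rbrakk> \<Longrightarrow> C \<subseteq> X \<or> C \<subseteq> Y"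
  shows "dim (X \<union> Y) = dim X + dim Y"
proof -
  obtain B where B: "B \<subseteq> X" "independent B" "X \<subseteq> span B" "card B = dim X"
    using basis_exists by blast
  obtain B' where B': "B' \<subseteq> Y" "independent B'" "Y \<subseteq> span B'" "card B' = dim Y"
    using basis_exists by blast
  have fin: "finite B" "finite B'"
    using B B' assms finite_subset by blast+
  have "independent (B \<union> B')"
  proof
    assume dep: "dependent (B \<union> B')"
    let ?\<D> = "{D. D \<subseteq> B \<union> B' \<and> dependent D}"
    have "finite ?\<D>" "?\<D> \<noteq> {}"
      using fin dep by auto
    then obtain C where C: "C \<in> ?\<D>" and min: "\<And>D. D \<in> ?\<D> \<Longrightarrow> D \<subseteq> C \<Longrightarrow> D = C"
      using finite_has_minimal[of ?\<D>] by metis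
    have "independent D" if "D \<subset> C" for D
      using min[of D] C that by blast
    then have "C \<subseteq> X \<or> C \<subseteq> Y"
      using sep[of C] C B B' by blast
    then have "C \<subseteq> B \<or> C \<subseteq> B'"
      using C B B' \<open>X \<inter> Y = {}\<close> by blast
    then show False
      using C B B' dependent_mono by blast
  qed
  moreover have "X \<union> Y \<subseteq> span (B \<union> B')"
    using B B' span_mono[of B "B \<union> B'"] span_mono[of B' "B \<union> B'"] by blast
  ultimately have "dim (X \<union> Y) = card (B \<union> B')"
    using B B' by (intro dim_unique) auto
  also have "\<dots> = card B + card B'"
    using B B' fin \<open>X \<inter> Y = {}\<close> by (intro card_Un_disjoint) auto
  finally show ?thesis
    using B B' by simp
qed

section \<open>Hyperplanes, chambers and their signs\<close>

lemma sign_mult_eq_Plus_iff: "s * t = Plus \<longleftrightarrow> s = t"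
  by (simp add: times_sign_def)

text \<open>Changing the orientation multiplies both signs by the same group element. Agreement can
  thus be tested in whichever orientation is convenient.\<close>

lemma eps_eq_iff: "eps f \<sigma> C = eps f \<sigma> D \<longleftrightarrow> eps f \<rho> C = eps f \<rho> D"
  by (cases \<sigma>; cases \<rho>; cases "THE \<tau>. C \<subseteq> half_space f \<tau>";
      cases "THE \<tau>. D \<subseteq> half_space f \<tau>")
    (simp_all add: eps_def times_sign_def)

lemma sign_eqI: "(s = Plus \<longleftrightarrow> t = Plus) \<Longrightarrow> s = t"
  by (cases s; cases t) auto

locale arrangement =
  fixes A :: "(real ^ 'l) set set" and \<alpha> :: "(real ^ 'l) set \<Rightarrow> real ^ 'l \<Rightarrow> real"
  assumes central: "central_arrangement A" and forms: "defining_forms A \<alpha>"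
begin

lemma finite_A: "finite A"
  using central by (simp add: central_arrangement_def)

lemma linear_form: "H \<in> A \<Longrightarrow> linear (\<alpha> H)"
  using forms by (simp add: defining_forms_def)

lemma mem_hyperplane_iff: "H \<in> A \<Longrightarrow> x \<in> H \<longleftrightarrow> \<alpha> H x = 0"
  using forms by (auto simp: defining_forms_def)

lemma form_eq_inner: "H \<in> A \<Longrightarrow> \<alpha> H x = normal (\<alpha> H) \<bullet> x"
  by (rule linear_eq_inner_normal[OF linear_form])

lemma hyperplane_eq_inner: "H \<in> A \<Longrightarrow> H = {x. normal (\<alpha> H) \<bullet> x = 0}"
  using mem_hyperplane_iff form_eq_inner by auto

lemma normal_nonzero:
  assumes "H \<in> A"
  shows "normal (\<alpha> H) \<noteq> 0"
proof
  assume "normal (\<alpha> H) = 0"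
  then have "H = UNIV"
    using hyperplane_eq_inner[OF assms] by simp
  then show False
    using central assms by (auto simp: central_arrangement_def linear_hyperplane_def)
qed

lemma normal_parallel_imp_eq:
  assumes "H \<in> A" "K \<in> A" "normal (\<alpha> H) = c *\<^sub>R normal (\<alpha> K)"
  shows "H = K"
proof -
  have "c \<noteq> 0"
    using assms normal_nonzero by force
  then show ?thesis
    using hyperplane_eq_inner[OF assms(1)] hyperplane_eq_inner[OF assms(2)] assms(3) by auto
qed

lemma inj_on_normal: "inj_on (\<lambda>H. normal (\<alpha> H)) A"
  by (rule inj_onI, rule normal_parallel_imp_eq[where c = 1]) auto

text \<open>The intersection of the hyperplanes is the orthogonal complement of the span of their
  normals. This turns decomposability into a statement about dimensions of sets of vectors.\<close>

lemma arr_rank_eq_dim_normals: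
  assumes "B \<subseteq> A"
  shows "arr_rank B = dim ((\<lambda>H. normal (\<alpha> H)) ` B)"
proof -
  have "\<Inter>B = {y \<in> UNIV. \<forall>x\<in>(\<lambda>H. normal (\<alpha> H)) ` B. orthogonal x y}"
    using assms hyperplane_eq_inner by (fastforce simp: orthogonal_def)
  also have "\<dots> = {y \<in> UNIV. \<forall>x\<in>span ((\<lambda>H. normal (\<alpha> H)) ` B). orthogonal x y}"
    using orthogonal_to_span span_base by (fastforce simp: orthogonal_commute)
  finally show ?thesis
    using dim_subspace_orthogonal_to_vectors[of "span ((\<lambda>H. normal (\<alpha> H)) ` B)" UNIV]
    by (simp add: arr_rank_def)
qed

lemma open_half_space:
  assumes "H \<in> A"
  shows "open (half_space (\<alpha> H) \<sigma>)"
  using open_halfspace_gt[of 0 "normal (\<alpha> H)"] open_halfspace_lt[of "normal (\<alpha> H)" 0]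
  by (cases \<sigma>) (simp_all add: form_eq_inner[OF assms])

lemma half_space_nonempty:
  assumes "H \<in> A"
  shows "half_space (\<alpha> H) \<sigma> \<noteq> {}"
proof -
  have "normal (\<alpha> H) \<in> half_space (\<alpha> H) Plus" "- normal (\<alpha> H) \<in> half_space (\<alpha> H) Minus"
    using normal_nonzero[OF assms] by (auto simp: form_eq_inner[OF assms])
  then show ?thesis
    by (cases \<sigma>) auto
qed

text \<open>A finite union of hyperplanes is negligible and cannot cover a nonempty open set; the
  chamber is the component of a point that is left over. Chambers with prescribed signs are produced
  in this way.\<close>

lemma chamber_meets_open:
  assumes "open U" "U \<noteq> {}"
  obtains C x where "C \<in> chambers A" "x \<in> C" "x \<in> U"
proof -
  have "negligible H" if "H \<in> A" for H
    using hyperplane_eq_inner[OF that] negligible_hyperplane[of "normal (\<alpha> H)" 0]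
      normal_nonzero[OF that] by simp
  then have "negligible (\<Union>A)"
    using finite_A by (intro negligible_Union) auto
  then have "\<not> U \<subseteq> \<Union>A"
    using open_not_negligible[OF assms] negligible_subset by blast
  then obtain x where "x \<in> U" "x \<in> UNIV - \<Union>A"
    by blast
  then show thesis
    using that[of "connected_component_set (UNIV - \<Union>A) x" x]
    by (auto simp: chambers_def components_def)
qed

lemma chamber_nonempty: "C \<in> chambers A \<Longrightarrow> C \<noteq> {}"
  unfolding chambers_def by (rule in_components_nonempty)

lemma in_half_space_of_chamber:
  assumes "C \<in> chambers A" "H \<in> A" "x \<in> C"
  obtains \<sigma> where "x \<in> half_space (\<alpha> H) \<sigma>"
proof -
  have "x \<notin> H"
    using assms in_components_subset unfolding chambers_def by blast
  then have "\<alpha> H x \<noteq> 0"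
    using mem_hyperplane_iff[OF \<open>H \<in> A\<close>] by blast
  then have "\<alpha> H x > 0 \<or> \<alpha> H x < 0"
    by linarith
  then show thesis
    using that[of Plus] that[of Minus] by auto
qed

lemma in_half_space_unique:
  "x \<in> half_space f \<sigma> \<Longrightarrow> x \<in> half_space f \<rho> \<longleftrightarrow> \<rho> = \<sigma>"
  by (cases \<sigma>; cases \<rho>) auto

text \<open>A chamber is connected and covered by the two disjoint open half-spaces of
  \<open>H\<close>, so it cannot meet both.\<close>

lemma chamber_subset_half_space:
  assumes "C \<in> chambers A" "H \<in> A" "x \<in> C" "x \<in> half_space (\<alpha> H) \<sigma>"
  shows "C \<subseteq> half_space (\<alpha> H) \<sigma>"
proof
  fix y assume "y \<in> C"
  then obtain \<tau> where \<tau>: "y \<in> half_space (\<alpha> H) \<tau>"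
    using in_half_space_of_chamber assms by blast
  have "\<tau> = \<sigma>"
  proof (rule ccontr)
    assume "\<tau> \<noteq> \<sigma>"
    let ?P = "half_space (\<alpha> H) \<sigma>" and ?N = "half_space (\<alpha> H) \<tau>"
    have "C \<subseteq> ?P \<union> ?N"
    proof
      fix z assume "z \<in> C"
      then obtain \<rho> where "z \<in> half_space (\<alpha> H) \<rho>"
        using in_half_space_of_chamber assms by blast
      moreover have "\<rho> = \<sigma> \<or> \<rho> = \<tau>"
        using \<open>\<tau> \<noteq> \<sigma>\<close> by (cases \<rho>; cases \<sigma>; cases \<tau>) auto
      ultimately show "z \<in> ?P \<union> ?N" by blast
    qed
    moreover have "?P \<inter> ?N \<inter> C = {}"
      using \<open>\<tau> \<noteq> \<sigma>\<close> in_half_space_unique by blast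
    moreover have "connected C"
      using assms(1) in_components_connected unfolding chambers_def by blast
    ultimately have "?P \<inter> C = {} \<or> ?N \<inter> C = {}"
      using open_half_space[OF \<open>H \<in> A\<close>] by (intro connectedD) auto
    then show False
      using assms \<tau> \<open>y \<in> C\<close> by blast
  qed
  then show "y \<in> half_space (\<alpha> H) \<sigma>"
    using \<tau> by simp
qed

text \<open>Replaces the definite description in \<open>eps\<close> by a test at any single point of
  the chamber.\<close>

lemma eps_eq_Plus_iff:
  assumes "C \<in> chambers A" "H \<in> A" "x \<in> C"
  shows "eps (\<alpha> H) \<sigma> C = Plus \<longleftrightarrow> x \<in> half_space (\<alpha> H) \<sigma>"
proof -
  obtain \<tau> where \<tau>: "x \<in> half_space (\<alpha> H) \<tau>"
    using in_half_space_of_chamber assms by blast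
  have "(THE \<tau>. C \<subseteq> half_space (\<alpha> H) \<tau>) = \<tau>"
    using chamber_subset_half_space[OF assms \<tau>] in_half_space_unique[OF \<tau>] \<open>x \<in> C\<close>
    by (intro the_equality) auto
  then show ?thesis
    using in_half_space_unique[OF \<tau>] by (auto simp: eps_def sign_mult_eq_Plus_iff)
qed

lemma convex_half_space:
  assumes "H \<in> A"
  shows "convex (half_space (\<alpha> H) \<sigma>)"
  using convex_halfspace_gt[of 0 "normal (\<alpha> H)"] convex_halfspace_lt[of "normal (\<alpha> H)" 0]
  by (cases \<sigma>) (simp_all add: form_eq_inner[OF assms])

text \<open>A segment joining points of the two chambers stays, by convexity, on one side of every
  hyperplane. It therefore avoids all of them and lies in a single component.\<close>

lemma chamber_eqI:
  assumes "C \<in> chambers A" "D \<in> chambers A"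
    and eps: "\<And>H. H \<in> A \<Longrightarrow> \<exists>\<sigma>. eps (\<alpha> H) \<sigma> C = eps (\<alpha> H) \<sigma> D"
  shows "C = D"
proof -
  obtain x y where "x \<in> C" "y \<in> D"
    using chamber_nonempty[OF assms(1)] chamber_nonempty[OF assms(2)] by blast
  have "z \<notin> H" if "H \<in> A" and z: "z \<in> closed_segment x y" for z H
  proof -
    obtain \<sigma> where x: "x \<in> half_space (\<alpha> H) \<sigma>"
      using in_half_space_of_chamber assms \<open>H \<in> A\<close> \<open>x \<in> C\<close> by blast
    have "eps (\<alpha> H) \<sigma> C = eps (\<alpha> H) \<sigma> D"
      using eps[OF \<open>H \<in> A\<close>] eps_eq_iff by blast
    then have y: "y \<in> half_space (\<alpha> H) \<sigma>"
      using x eps_eq_Plus_iff[OF assms(1) \<open>H \<in> A\<close> \<open>x \<in> C\<close>, of \<sigma>]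
        eps_eq_Plus_iff[OF assms(2) \<open>H \<in> A\<close> \<open>y \<in> D\<close>, of \<sigma>] by simp
    have "z \<in> half_space (\<alpha> H) \<sigma>"
      using x y z closed_segment_subset convex_half_space[OF \<open>H \<in> A\<close>] by blast
    then show ?thesis
      using mem_hyperplane_iff[OF \<open>H \<in> A\<close>] by (cases \<sigma>) auto
  qed
  then have sub: "closed_segment x y \<subseteq> UNIV - \<Union>A"
    by blast
  have C: "C \<in> components (UNIV - \<Union>A)" and D: "D \<in> components (UNIV - \<Union>A)"
    using assms by (simp_all add: chambers_def)
  have "closed_segment x y \<subseteq> C"
  proof (rule components_maximal[OF C _ sub])
    show "C \<inter> closed_segment x y \<noteq> {}"
      using \<open>x \<in> C\<close> ends_in_segment(1) by blast
  qed simp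
  then have "y \<in> C \<inter> D"
    using \<open>y \<in> D\<close> ends_in_segment(2) by blast
  then show ?thesis
    using components_nonoverlap[OF C D] by blast
qed

lemma chamber_with_eps:
  assumes "H \<in> A"
  obtains C where "C \<in> chambers A" "eps (\<alpha> H) \<sigma> C = s"
proof -
  \<comment> \<open>Every sign is its own inverse, so this is the solution of
    \<open>\<sigma> * \<tau> = s\<close>.\<close>
  define \<tau> where "\<tau> = s * \<sigma>"
  have \<tau>: "\<tau> = \<sigma> \<longleftrightarrow> s = Plus"
    by (cases s; cases \<sigma>) (simp_all add: \<tau>_def times_sign_def)
  obtain C x where "C \<in> chambers A" "x \<in> C" "x \<in> half_space (\<alpha> H) \<tau>"
    by (rule chamber_meets_open[OF open_half_space[OF assms] half_space_nonempty[OF assms]])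
  then have "eps (\<alpha> H) \<sigma> C = Plus \<longleftrightarrow> s = Plus"
    using eps_eq_Plus_iff[of C H x \<sigma>] in_half_space_unique[of x "\<alpha> H" \<tau> \<sigma>] assms \<tau> by auto
  then show thesis
    using that \<open>C \<in> chambers A\<close> sign_eqI by blast
qed

section \<open>Unanimity and the case of a single hyperplane\<close>

lemma const_tuple_in_tuples: "c \<in> X \<Longrightarrow> const_tuple m c \<in> tuples m X"
  by (auto simp: const_tuple_def tuples_def)

lemma eps_tuple_const: "eps_tuple m f \<sigma> (const_tuple m C) = const_tuple m (eps f \<sigma> C)"
  by (auto simp: eps_tuple_def const_tuple_def)

lemma admissible_map_chamber:
  assumes "\<Phi> \<in> admissible_maps A \<alpha> m" "Cs \<in> tuples m (chambers A)"
  shows "\<Phi> Cs \<in> chambers A"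
  using assms by (auto simp: admissible_maps_def chamber_maps_def)

text \<open>Orient each hyperplane towards \<open>C\<close>. The sign tuple is then constantly
  \<open>Plus\<close>, and the normalisation of \<open>\<phi>\<close> keeps the image on the same
  side as \<open>C\<close>.\<close>

lemma admissible_map_diagonal:
  assumes \<Phi>: "\<Phi> \<in> admissible_maps A \<alpha> m" and C: "C \<in> chambers A"
  shows "\<Phi> (const_tuple m C) = C"
proof (rule chamber_eqI)
  show "\<Phi> (const_tuple m C) \<in> chambers A"
    using admissible_map_chamber[OF \<Phi>] const_tuple_in_tuples[OF C] .
  show "C \<in> chambers A" by fact
  fix H assume "H \<in> A"
  obtain x where "x \<in> C"
    using chamber_nonempty[OF C] by blast
  then obtain \<sigma> where "x \<in> half_space (\<alpha> H) \<sigma>"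
    using in_half_space_of_chamber C \<open>H \<in> A\<close> by blast
  then have \<sigma>: "eps (\<alpha> H) \<sigma> C = Plus"
    using eps_eq_Plus_iff C \<open>H \<in> A\<close> \<open>x \<in> C\<close> by blast
  obtain \<phi> where "\<phi> H \<sigma> (const_tuple m Plus) = Plus"
    and "\<And>Cs. Cs \<in> tuples m (chambers A) \<Longrightarrow>
      eps (\<alpha> H) \<sigma> (\<Phi> Cs) = \<phi> H \<sigma> (eps_tuple m (\<alpha> H) \<sigma> Cs)"
    using \<Phi> \<open>H \<in> A\<close> unfolding admissible_maps_def by blast
  then have "eps (\<alpha> H) \<sigma> (\<Phi> (const_tuple m C)) = Plus"
    using const_tuple_in_tuples[OF C] \<sigma> by (simp add: eps_tuple_const)
  then show "\<exists>\<sigma>. eps (\<alpha> H) \<sigma> (\<Phi> (const_tuple m C)) = eps (\<alpha> H) \<sigma> C"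
    using \<sigma> by (intro exI[of _ \<sigma>]) simp
qed

text \<open>With one hyperplane the sign tuple determines the tuple of chambers, so
  \<open>\<phi>\<close> can be read off from \<open>\<Phi>\<close>. Its only prescribed value is the
  one that the diagonal condition supplies.\<close>

lemma singleton_admissible_map:
  assumes A: "A = {H}" and \<Phi>: "\<Phi> \<in> chamber_maps A m"
    and diag: "\<And>C. C \<in> chambers A \<Longrightarrow> \<Phi> (const_tuple m C) = C"
  shows "\<Phi> \<in> admissible_maps A \<alpha> m"
proof -
  let ?T = "tuples m (chambers A)"
  have inj: "Cs = Ds" if eq: "eps_tuple m (\<alpha> H) \<sigma> Cs = eps_tuple m (\<alpha> H) \<sigma> Ds"
    and "Cs \<in> ?T" "Ds \<in> ?T" for Cs Ds \<sigma>
  proof (rule PiE_ext)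
    show "Cs \<in> {1..m} \<rightarrow>\<^sub>E chambers A" "Ds \<in> {1..m} \<rightarrow>\<^sub>E chambers A"
      using that by (simp_all add: tuples_def)
    fix i assume i: "i \<in> {1..m}"
    show "Cs i = Ds i"
    proof (rule chamber_eqI)
      show "Cs i \<in> chambers A" "Ds i \<in> chambers A"
        using that i by (auto simp: tuples_def)
      show "\<exists>\<sigma>. eps (\<alpha> K) \<sigma> (Cs i) = eps (\<alpha> K) \<sigma> (Ds i)" if "K \<in> A" for K
        using fun_cong[OF eq, of i] i that A by (auto simp: eps_tuple_def)
    qed
  qed
  \<comment> \<open>Setting the constant \<open>Plus\<close> tuple apart makes the normalisation
    hold by definition; agreement with \<open>\<Phi>\<close> at that tuple is checked in the first
    case below. Elsewhere \<open>SOME\<close> selects the preimage, unique by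
    \<open>inj\<close>.\<close>
  define \<phi> where "\<phi> K \<sigma> t = (if t = const_tuple m Plus then Plus
    else eps (\<alpha> H) \<sigma> (\<Phi> (SOME Cs. Cs \<in> ?T \<and> eps_tuple m (\<alpha> H) \<sigma> Cs = t)))"
    for K :: "(real ^ 'l) set" and \<sigma> t
  have "eps (\<alpha> H) \<sigma> (\<Phi> Cs) = \<phi> H \<sigma> (eps_tuple m (\<alpha> H) \<sigma> Cs)" if Cs: "Cs \<in> ?T" for \<sigma> Cs
  proof (cases "eps_tuple m (\<alpha> H) \<sigma> Cs = const_tuple m Plus")
    case True
    obtain C where C: "C \<in> chambers A" "eps (\<alpha> H) \<sigma> C = Plus"
      using chamber_with_eps A by blast
    then have "Cs = const_tuple m C"
      using inj[of \<sigma> Cs "const_tuple m C"] True Cs C(2) const_tuple_in_tuples[OF C(1)]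
      by (simp add: eps_tuple_const)
    then show ?thesis
      using True C diag by (simp add: \<phi>_def)
  next
    case False
    have "(SOME Ds. Ds \<in> ?T \<and> eps_tuple m (\<alpha> H) \<sigma> Ds = eps_tuple m (\<alpha> H) \<sigma> Cs) = Cs"
      using Cs inj by (intro some_equality) auto
    then show ?thesis
      using False by (simp add: \<phi>_def)
  qed
  moreover have "\<phi> H \<sigma> (const_tuple m Plus) = Plus" for \<sigma>
    by (simp add: \<phi>_def)
  ultimately show ?thesis
    unfolding admissible_maps_def using \<Phi> A by blast
qed

section \<open>Circuits of the arrangement\<close>

text \<open>A circuit of the linear matroid of the normals. Minimality is stated for sets of
  vectors, which match sets of hyperplanes because \<open>normal\<close> is injective along
  \<open>A\<close>.\<close>

definition circuit :: "(real ^ 'l) set set \<Rightarrow> bool" where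
  "circuit C \<longleftrightarrow> C \<subseteq> A \<and> dependent ((\<lambda>H. normal (\<alpha> H)) ` C)
    \<and> (\<forall>D. D \<subset> (\<lambda>H. normal (\<alpha> H)) ` C \<longrightarrow> independent D)"

text \<open>One relation in two forms: between the normals, to realise sign patterns, and between
  the values of the forms at a point, to exclude them.\<close>

lemma circuit_relation:
  assumes "circuit C"
  shows "\<exists>u. (\<forall>v\<in>(\<lambda>H. normal (\<alpha> H)) ` C. u v \<noteq> 0)
    \<and> (\<Sum>v\<in>(\<lambda>H. normal (\<alpha> H)) ` C. u v *\<^sub>R v) = 0
    \<and> (\<forall>x. (\<Sum>H\<in>C. u (normal (\<alpha> H)) * \<alpha> H x) = 0)"
proof -
  let ?n = "\<lambda>H. normal (\<alpha> H)"
  have C: "C \<subseteq> A" "finite (?n ` C)"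
    using assms finite_A finite_subset unfolding circuit_def by blast+
  obtain u where u: "\<And>v. v \<in> ?n ` C \<Longrightarrow> u v \<noteq> 0" "(\<Sum>v\<in>?n ` C. u v *\<^sub>R v) = 0"
    using minimal_dependent_coeffs[OF C(2)] assms unfolding circuit_def by blast
  have "(\<Sum>H\<in>C. u (?n H) * \<alpha> H x) = 0" for x
  proof -
    have "(\<Sum>H\<in>C. u (?n H) * \<alpha> H x) = (\<Sum>H\<in>C. (u (?n H) *\<^sub>R ?n H) \<bullet> x)"
      using C(1) by (intro sum.cong) (auto simp: form_eq_inner)
    also have "\<dots> = (\<Sum>H\<in>C. u (?n H) *\<^sub>R ?n H) \<bullet> x"
      by (rule inner_sum_left[symmetric])
    also have "(\<Sum>H\<in>C. u (?n H) *\<^sub>R ?n H) = (\<Sum>v\<in>?n ` C. u v *\<^sub>R v)"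
      using inj_on_subset[OF inj_on_normal C(1)] by (simp add: sum.reindex)
    finally show ?thesis
      using u(2) by simp
  qed
  then show ?thesis
    using u by blast
qed

text \<open>A circuit of one element would have a zero normal, and one of two elements would have
  parallel normals, that is, equal hyperplanes.\<close>

lemma circuit_card_ge_3:
  assumes "circuit C"
  shows "card C \<ge> 3"
proof (rule ccontr)
  let ?n = "\<lambda>H. normal (\<alpha> H)"
  assume "\<not> card C \<ge> 3"
  moreover have C: "C \<subseteq> A" "dependent (?n ` C)"
    using assms unfolding circuit_def by auto
  moreover have "finite C"
    using C finite_A finite_subset by blast
  moreover have "C \<noteq> {}"
    using C independent_empty by auto
  ultimately consider "card C = 1" | "card C = 2"
    by (metis One_nat_def Suc_1 card_0_eq le_SucE not_less_eq_eq numeral_3_eq_3 le_zero_eq)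
  then show False
  proof cases
    case 1
    then obtain H where "C = {H}"
      by (rule card_1_singletonE)
    then show False
      using C normal_nonzero[of H] by simp
  next
    case 2
    then obtain H K where HK: "C = {H, K}" "H \<noteq> K"
      by (auto simp: card_2_iff)
    then have "?n H \<noteq> ?n K"
      using C inj_on_normal unfolding inj_on_def by blast
    obtain u where "\<forall>v\<in>?n ` C. u v \<noteq> 0" "(\<Sum>v\<in>?n ` C. u v *\<^sub>R v) = 0"
      using circuit_relation[OF assms] by blast
    then have u: "u (?n H) \<noteq> 0" "u (?n H) *\<^sub>R ?n H + u (?n K) *\<^sub>R ?n K = 0"
      using \<open>C = {H, K}\<close> \<open>?n H \<noteq> ?n K\<close> by simp_all
    have "?n H = (1 / u (?n H)) *\<^sub>R (u (?n H) *\<^sub>R ?n H)"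
      using u(1) by simp
    also have "u (?n H) *\<^sub>R ?n H = - (u (?n K) *\<^sub>R ?n K)"
      using u(2) by (rule eq_neg_iff_add_eq_0[THEN iffD2])
    also have "(1 / u (?n H)) *\<^sub>R \<dots> = (- u (?n K) / u (?n H)) *\<^sub>R ?n K"
      by simp
    finally have "?n H = (- u (?n K) / u (?n H)) *\<^sub>R ?n K" .
    then show False
      using normal_parallel_imp_eq[of H K] HK C by blast
  qed
qed

text \<open>Every circuit lies in \<open>P\<close> or in \<open>A - P\<close>, so the ranks of these
  two parts add up; if both were nonempty they would decompose \<open>A\<close>.\<close>

lemma indecomposable_circuit_closed:
  assumes "\<not> decomposable A" and "P \<subseteq> A" "P \<noteq> {}"
    and sep: "\<And>C. circuit C \<Longrightarrow> C \<inter> P \<noteq> {} \<Longrightarrow> C \<subseteq> P"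
  shows "P = A"
proof (rule ccontr)
  let ?n = "\<lambda>H. normal (\<alpha> H)"
  assume "P \<noteq> A"
  let ?Q = "A - P"
  have "dim (?n ` P \<union> ?n ` ?Q) = dim (?n ` P) + dim (?n ` ?Q)"
  proof (rule dim_union_of_circuit_separation)
    show "finite (?n ` P)" "finite (?n ` ?Q)"
      using finite_A \<open>P \<subseteq> A\<close> finite_subset by blast+
    show "?n ` P \<inter> ?n ` ?Q = {}"
      using inj_on_normal \<open>P \<subseteq> A\<close> unfolding inj_on_def by blast
    fix X assume X: "X \<subseteq> ?n ` P \<union> ?n ` ?Q" "dependent X" "\<And>D. D \<subset> X \<Longrightarrow> independent D"
    then obtain C where C: "C \<subseteq> P \<union> ?Q" "X = ?n ` C"
      unfolding image_Un[symmetric] by (meson subset_imageE)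
    then have "circuit C"
      using X \<open>P \<subseteq> A\<close> unfolding circuit_def by blast
    then show "X \<subseteq> ?n ` P \<or> X \<subseteq> ?n ` ?Q"
      using sep[of C] C by blast
  qed
  moreover have "?n ` P \<union> ?n ` ?Q = ?n ` A"
    using \<open>P \<subseteq> A\<close> by blast
  ultimately have "arr_rank A = arr_rank P + arr_rank ?Q"
    using \<open>P \<subseteq> A\<close> by (simp add: arr_rank_eq_dim_normals)
  then have "decomposable A"
    unfolding decomposable_def using assms(2,3) \<open>P \<noteq> A\<close> by (intro exI[of _ P] exI[of _ ?Q]) auto
  then show False
    using assms(1) by simp
qed

section \<open>Dictators on hyperplanes and on circuits\<close>

text \<open>Fixing the orientation \<open>Plus\<close> loses nothing, by
  \<open>eps_eq_iff\<close>.\<close>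

definition dictates :: "nat \<Rightarrow> nat \<Rightarrow> ((nat \<Rightarrow> (real ^ 'l) set) \<Rightarrow> (real ^ 'l) set)
    \<Rightarrow> (real ^ 'l) set \<Rightarrow> bool" where
  "dictates m h \<Phi> H \<longleftrightarrow>
    (\<forall>Cs\<in>tuples m (chambers A). eps (\<alpha> H) Plus (\<Phi> Cs) = eps (\<alpha> H) Plus (Cs h))"

text \<open>If \<open>h\<close> and \<open>k\<close> differ, their chambers can be put on opposite
  sides of \<open>H\<close>, and the outcome cannot follow both.\<close>

lemma dictates_unique:
  assumes "H \<in> A" "h \<in> {1..m}" "k \<in> {1..m}" "dictates m h \<Phi> H" "dictates m k \<Phi> H"
  shows "h = k"
proof (rule ccontr)
  assume "h \<noteq> k"
  obtain C D where "C \<in> chambers A" "eps (\<alpha> H) Plus C = Plus"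
    and "D \<in> chambers A" "eps (\<alpha> H) Plus D = Minus"
    using chamber_with_eps[OF \<open>H \<in> A\<close>] by metis
  moreover define Cs where "Cs = (\<lambda>i\<in>{1..m}. if i = h then C else D)"
  ultimately have "Cs \<in> tuples m (chambers A)"
    and "eps (\<alpha> H) Plus (Cs h) \<noteq> eps (\<alpha> H) Plus (Cs k)"
    using assms \<open>h \<noteq> k\<close> by (auto simp: tuples_def)
  then show False
    using assms unfolding dictates_def by metis
qed

text \<open>Reduces to \<open>circuit_dictator\<close> with the hyperplanes of \<open>C\<close> as
  issues. Non-uniform votes are realised by chambers, and the outcome is itself a chamber, so the
  linear relation prevents it from being uniform.\<close>

lemma circuit_dictates:
  assumes \<Phi>: "\<Phi> \<in> admissible_maps A \<alpha> m" and "circuit C"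
  shows "\<exists>h\<in>{1..m}. \<forall>H\<in>C. dictates m h \<Phi> H"
proof -
  let ?n = "\<lambda>H. normal (\<alpha> H)" and ?V = "{1..m}" and ?T = "tuples m (chambers A)"
  have "C \<subseteq> A" and min: "\<And>D. D \<subset> ?n ` C \<Longrightarrow> independent D"
    using \<open>circuit C\<close> unfolding circuit_def by auto
  have "finite C"
    using \<open>C \<subseteq> A\<close> finite_A finite_subset by blast
  have "C \<noteq> {}"
    using circuit_card_ge_3[OF \<open>circuit C\<close>] by auto
  obtain u where "\<forall>v\<in>?n ` C. u v \<noteq> 0" and u0: "(\<Sum>v\<in>?n ` C. u v *\<^sub>R v) = 0"
    and rel: "\<forall>x. (\<Sum>H\<in>C. u (?n H) * \<alpha> H x) = 0"
    using circuit_relation[OF \<open>circuit C\<close>] by blast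
  then have u: "\<And>v. v \<in> ?n ` C \<Longrightarrow> u v \<noteq> 0"
    by blast
  obtain \<phi> where \<phi>1: "\<And>H \<sigma>. H \<in> A \<Longrightarrow> \<phi> H \<sigma> (const_tuple m Plus) = Plus"
    and \<phi>: "\<And>H \<sigma> Cs. H \<in> A \<Longrightarrow> Cs \<in> ?T \<Longrightarrow>
      eps (\<alpha> H) \<sigma> (\<Phi> Cs) = \<phi> H \<sigma> (eps_tuple m (\<alpha> H) \<sigma> Cs)"
    using \<Phi> unfolding admissible_maps_def by blast
  define \<sigma> where "\<sigma> H = (if u (?n H) > 0 then Plus else Minus)" for H
  \<comment> \<open>\<open>ind S\<close> is the sign tuple in which exactly the voters of
    \<open>S\<close> are on the positive side; \<open>F H S\<close> says that the outcome then is as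
    well.\<close>
  define ind where "ind S = (\<lambda>i\<in>?V. if i \<in> S then Plus else Minus)" for S
  define F where "F H S \<longleftrightarrow> \<phi> H (\<sigma> H) (ind S) = Plus" for H S
  have eps\<sigma>: "eps (\<alpha> H) (\<sigma> H) K = Plus \<longleftrightarrow> u (?n H) * \<alpha> H x > 0"
    if "K \<in> chambers A" "H \<in> C" "x \<in> K" for K H x
    using eps_eq_Plus_iff[of K H x "\<sigma> H"] that \<open>C \<subseteq> A\<close> u[of "?n H"]
    by (auto simp: \<sigma>_def zero_less_mult_iff split: if_splits)
  \<comment> \<open>Measuring \<open>H\<close> with the orientation \<open>\<sigma> H\<close> makes all coefficients of the relation positive.\<close>
  have ballot: "\<exists>K\<in>chambers A. \<forall>H\<in>C. eps (\<alpha> H) (\<sigma> H) K = Plus \<longleftrightarrow> H \<in> W"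
    if W: "\<exists>H\<in>C. H \<in> W" "\<exists>H\<in>C. H \<notin> W" for W
  proof -
    \<comment> \<open>The product of \<open>u\<close> and \<open>s\<close> is positive on the
      normals from \<open>W\<close> and negative on the others, so both signs occur by the
      assumption on \<open>W\<close>.\<close>
    define s where "s v = (if v \<in> ?n ` (C \<inter> W) then u v else - u v)" for v
    have s: "s (?n H) = (if H \<in> W then u (?n H) else - u (?n H))" if "H \<in> C" for H
      using that \<open>C \<subseteq> A\<close> inj_on_normal unfolding s_def inj_on_def by auto
    obtain H1 H2 where H: "H1 \<in> C" "H1 \<in> W" "H2 \<in> C" "H2 \<notin> W"
      using W by blast
    have "\<exists>x. \<forall>v\<in>?n ` C. (v \<bullet> x) * s v > 0"
    proof (rule circuit_signs_realizable[where u = u and p = "?n H1" and q = "?n H2"])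
      show "u (?n H1) * s (?n H1) > 0" "u (?n H2) * s (?n H2) < 0"
        using H s u by (auto simp: zero_less_mult_iff mult_less_0_iff neq_iff)
      show "s v \<noteq> 0" if "v \<in> ?n ` C" for v
        using u[OF that] by (simp add: s_def)
    qed (use u u0 min H \<open>finite C\<close> in auto)
    then obtain x where x: "\<And>H. H \<in> C \<Longrightarrow> (?n H \<bullet> x) * s (?n H) > 0"
      by blast
    \<comment> \<open>The point \<open>x\<close> may lie on hyperplanes of \<open>A\<close> outside
      \<open>C\<close>. The required inequalities are open conditions, so a point of some chamber
      satisfies them too.\<close>
    let ?U = "\<Inter>H\<in>C. {x. 0 < (?n H \<bullet> x) * s (?n H)}"
    have "open ?U"
      using \<open>finite C\<close> by (intro open_INT ballI open_Collect_less continuous_intros) auto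
    moreover have "?U \<noteq> {}"
      using x by blast
    ultimately obtain K y where K: "K \<in> chambers A" "y \<in> K" "y \<in> ?U"
      by (rule chamber_meets_open)
    have "eps (\<alpha> H) (\<sigma> H) K = Plus \<longleftrightarrow> H \<in> W" if "H \<in> C" for H
    proof -
      have "0 < \<alpha> H y * s (?n H)"
        using K that \<open>C \<subseteq> A\<close> form_eq_inner[of H y] by auto
      then show ?thesis
        using eps\<sigma>[OF K(1) that K(2)] s[OF that]
        by (auto simp: zero_less_mult_iff split: if_splits)
    qed
    then show ?thesis
      using K(1) by blast
  qed
  have "\<exists>h\<in>?V. \<forall>H\<in>C. \<forall>S\<subseteq>?V. F H S \<longleftrightarrow> h \<in> S"
  proof (rule circuit_dictator)
    show "card C \<ge> 3"
      using circuit_card_ge_3 \<open>circuit C\<close> .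
    show "F H ?V" if "H \<in> C" for H
    proof -
      have "ind ?V = const_tuple m Plus"
        by (auto simp: ind_def const_tuple_def)
      then show ?thesis
        using \<phi>1 that \<open>C \<subseteq> A\<close> by (auto simp: F_def)
    qed
    show "\<not> F H {}" if "H \<in> C" for H
    proof -
      \<comment> \<open>The normalisation of \<open>\<phi>\<close> fixes only its value at the
        constant \<open>Plus\<close> tuple. The value at the constant \<open>Minus\<close> tuple
        follows from unanimity, applied to a chamber on the negative side.\<close>
      obtain K where K: "K \<in> chambers A" "eps (\<alpha> H) (\<sigma> H) K = Minus"
        using chamber_with_eps[of H] \<open>H \<in> C\<close> \<open>C \<subseteq> A\<close> by blast
      have "ind {} = const_tuple m Minus"
        by (auto simp: ind_def const_tuple_def)
      then have "\<phi> H (\<sigma> H) (ind {}) = eps (\<alpha> H) (\<sigma> H) (\<Phi> (const_tuple m K))"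
        using \<phi>[of H "const_tuple m K" "\<sigma> H"] K that \<open>C \<subseteq> A\<close> const_tuple_in_tuples[OF K(1)]
        by (auto simp: eps_tuple_const)
      then show ?thesis
        using admissible_map_diagonal[OF \<Phi> K(1)] K(2) by (simp add: F_def)
    qed
    fix S :: "(real ^ 'l) set \<Rightarrow> nat set"
    assume S: "\<And>H. H \<in> C \<Longrightarrow> S H \<subseteq> ?V" "\<And>i. i \<in> ?V \<Longrightarrow> \<exists>H\<in>C. i \<in> S H"
      "\<And>i. i \<in> ?V \<Longrightarrow> \<exists>H\<in>C. i \<notin> S H"
    \<comment> \<open>Each voter \<open>i\<close> has a non-uniform pattern on \<open>C\<close>,
      hence a chamber realising it; its signs off \<open>C\<close> are left arbitrary.\<close>
    have "\<forall>i\<in>?V. \<exists>K. K \<in> chambers A \<and> (\<forall>H\<in>C. eps (\<alpha> H) (\<sigma> H) K = Plus \<longleftrightarrow> i \<in> S H)"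
    proof
      fix i assume "i \<in> ?V"
      show "\<exists>K. K \<in> chambers A \<and> (\<forall>H\<in>C. eps (\<alpha> H) (\<sigma> H) K = Plus \<longleftrightarrow> i \<in> S H)"
        using ballot[of "{H. i \<in> S H}"] S(2,3)[OF \<open>i \<in> ?V\<close>] unfolding mem_Collect_eq by blast
    qed
    from bchoice[OF this] obtain K where K: "\<And>i. i \<in> ?V \<Longrightarrow> K i \<in> chambers A"
      "\<And>i H. i \<in> ?V \<Longrightarrow> H \<in> C \<Longrightarrow> eps (\<alpha> H) (\<sigma> H) (K i) = Plus \<longleftrightarrow> i \<in> S H"
      by blast
    define Cs where "Cs = (\<lambda>i\<in>?V. K i)"
    have Cs: "Cs \<in> ?T"
      using K(1) by (auto simp: Cs_def tuples_def)
    have "eps_tuple m (\<alpha> H) (\<sigma> H) Cs = ind (S H)" if "H \<in> C" for H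
      unfolding eps_tuple_def ind_def
    proof (rule restrict_ext)
      fix i assume "i \<in> ?V"
      then show "eps (\<alpha> H) (\<sigma> H) (Cs i) = (if i \<in> S H then Plus else Minus)"
        using K(2)[of i H] that by (intro sign_eqI) (auto simp: Cs_def)
    qed
    then have F: "F H (S H) \<longleftrightarrow> eps (\<alpha> H) (\<sigma> H) (\<Phi> Cs) = Plus" if "H \<in> C" for H
      using \<phi>[of H Cs "\<sigma> H"] that \<open>C \<subseteq> A\<close> Cs by (auto simp: F_def)
    have chamber: "\<Phi> Cs \<in> chambers A"
      using admissible_map_chamber[OF \<Phi> Cs] .
    then obtain x where "x \<in> \<Phi> Cs"
      using chamber_nonempty by blast
    then have F: "F H (S H) \<longleftrightarrow> u (?n H) * \<alpha> H x > 0" if "H \<in> C" for H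
      using F[OF that] eps\<sigma>[OF chamber that] by simp
    have nz: "u (?n H) * \<alpha> H x \<noteq> 0" if "H \<in> C" for H
    proof -
      have "H \<in> A"
        using that \<open>C \<subseteq> A\<close> by blast
      then obtain \<tau> where "x \<in> half_space (\<alpha> H) \<tau>"
        using in_half_space_of_chamber[OF chamber _ \<open>x \<in> \<Phi> Cs\<close>] by blast
      then have "\<alpha> H x \<noteq> 0"
        by (cases \<tau>) auto
      then show ?thesis
        using u that by simp
    qed
    \<comment> \<open>At the point \<open>x\<close> of the outcome the terms of the relation are
      nonzero with sum zero, so neither sign can be shared by all of them.\<close>
    have "\<exists>H\<in>C. u (?n H) * \<alpha> H x > 0"
    proof (rule ccontr)
      assume none: "\<not> ?thesis"
      have "- (u (?n H) * \<alpha> H x) > 0" if "H \<in> C" for H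
      proof -
        have "\<not> u (?n H) * \<alpha> H x > 0"
          using none that by blast
        then show ?thesis
          using nz[OF that] by linarith
      qed
      then have "(\<Sum>H\<in>C. - (u (?n H) * \<alpha> H x)) > 0"
        by (rule sum_pos[OF \<open>finite C\<close> \<open>C \<noteq> {}\<close>])
      then show False
        using rel by (simp add: sum_negf)
    qed
    moreover have "\<exists>H\<in>C. \<not> u (?n H) * \<alpha> H x > 0"
    proof (rule ccontr)
      assume "\<not> ?thesis"
      then have "u (?n H) * \<alpha> H x > 0" if "H \<in> C" for H
        using that by blast
      then have "(\<Sum>H\<in>C. u (?n H) * \<alpha> H x) > 0"
        by (rule sum_pos[OF \<open>finite C\<close> \<open>C \<noteq> {}\<close>])
      then show False
        using rel by simp
    qed
    ultimately show "(\<exists>H\<in>C. F H (S H)) \<and> (\<exists>H\<in>C. \<not> F H (S H))"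
      using F by simp
  qed auto
  then obtain h where h: "h \<in> ?V" "\<forall>H\<in>C. \<forall>S\<subseteq>?V. F H S \<longleftrightarrow> h \<in> S" ..
  have "dictates m h \<Phi> H" if "H \<in> C" for H
    unfolding dictates_def
  proof
    fix Cs assume Cs: "Cs \<in> ?T"
    \<comment> \<open>Every sign tuple equals \<open>ind\<close> of its set of \<open>Plus\<close>
      voters, so the rule for \<open>F\<close> applies to arbitrary tuples of chambers.\<close>
    let ?S = "{i \<in> ?V. eps (\<alpha> H) (\<sigma> H) (Cs i) = Plus}"
    have "eps_tuple m (\<alpha> H) (\<sigma> H) Cs = ind ?S"
      unfolding eps_tuple_def ind_def
    proof (rule restrict_ext)
      fix i assume "i \<in> ?V"
      then show "eps (\<alpha> H) (\<sigma> H) (Cs i) = (if i \<in> ?S then Plus else Minus)"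
        by (intro sign_eqI) simp
    qed
    then have "eps (\<alpha> H) (\<sigma> H) (\<Phi> Cs) = Plus \<longleftrightarrow> F H ?S"
      using \<phi>[of H Cs "\<sigma> H"] that \<open>C \<subseteq> A\<close> Cs by (auto simp: F_def)
    also have "\<dots> \<longleftrightarrow> eps (\<alpha> H) (\<sigma> H) (Cs h) = Plus"
    proof -
      have "F H ?S \<longleftrightarrow> h \<in> ?S"
        by (rule h(2)[rule_format, OF that]) (rule Collect_restrict)
      then show ?thesis
        using h(1) by simp
    qed
    finally have "eps (\<alpha> H) (\<sigma> H) (\<Phi> Cs) = eps (\<alpha> H) (\<sigma> H) (Cs h)"
      by (rule sign_eqI)
    then show "eps (\<alpha> H) Plus (\<Phi> Cs) = eps (\<alpha> H) Plus (Cs h)"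
      by (rule eps_eq_iff[THEN iffD1])
  qed
  then show ?thesis
    using h(1) by blast
qed

text \<open>A chamber is determined by its sides, so once \<open>h\<close> dictates on every
  hyperplane the outcome is the chamber of \<open>h\<close>.\<close>

lemma indecomposable_admissible_projective:
  assumes indec: "\<not> decomposable A" and "card A \<ge> 3" and \<Phi>: "\<Phi> \<in> admissible_maps A \<alpha> m"
  shows "projective A m \<Phi>"
proof -
  obtain H where "H \<in> A"
    using \<open>card A \<ge> 3\<close> by fastforce
  \<comment> \<open>If no circuit contained \<open>H\<close>, then \<open>{H}\<close> would be
    closed under circuits and hence all of \<open>A\<close>, contrary to the cardinality.\<close>
  have "\<exists>C. circuit C \<and> H \<in> C"
  proof (rule ccontr)
    assume "\<not> ?thesis"
    then have "{H} = A"
      using \<open>H \<in> A\<close> by (intro indecomposable_circuit_closed[OF indec]) auto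
    then have "card A = 1"
      by (metis is_singletonI is_singleton_altdef)
    then show False
      using \<open>card A \<ge> 3\<close> by simp
  qed
  then obtain C where C: "circuit C" "H \<in> C"
    by blast
  then obtain h where h: "h \<in> {1..m}" "dictates m h \<Phi> H"
    using circuit_dictates[OF \<Phi>] by blast
  \<comment> \<open>A circuit meeting this set has a dictator \<open>k\<close> of its own; at a
    common hyperplane \<open>dictates_unique\<close> forces \<open>k\<close> to equal
    \<open>h\<close>.\<close>
  have "{H \<in> A. dictates m h \<Phi> H} = A"
  proof (rule indecomposable_circuit_closed[OF indec])
    show "{H \<in> A. dictates m h \<Phi> H} \<noteq> {}"
      using h \<open>H \<in> A\<close> by blast
    fix D assume D: "circuit D" "D \<inter> {H \<in> A. dictates m h \<Phi> H} \<noteq> {}"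
    obtain k where k: "k \<in> {1..m}" "\<And>K. K \<in> D \<Longrightarrow> dictates m k \<Phi> K"
      using circuit_dictates[OF \<Phi> D(1)] by blast
    obtain K where "K \<in> A" "K \<in> D" "dictates m h \<Phi> K"
      using D by blast
    then have "h = k"
      using dictates_unique h(1) k by blast
    moreover have "D \<subseteq> A"
      using D(1) by (simp add: circuit_def)
    ultimately show "D \<subseteq> {H \<in> A. dictates m h \<Phi> H}"
      using k by blast
  qed auto
  then have all: "dictates m h \<Phi> K" if "K \<in> A" for K
    using that by blast
  have "\<Phi> Cs = Cs h" if Cs: "Cs \<in> tuples m (chambers A)" for Cs
  proof (rule chamber_eqI)
    show "\<Phi> Cs \<in> chambers A"
      using admissible_map_chamber[OF \<Phi> Cs] .
    show "Cs h \<in> chambers A"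
      using Cs h(1) by (auto simp: tuples_def)
    show "\<exists>\<sigma>. eps (\<alpha> K) \<sigma> (\<Phi> Cs) = eps (\<alpha> K) \<sigma> (Cs h)" if "K \<in> A" for K
      using all[OF that] Cs unfolding dictates_def by blast
  qed
  then show ?thesis
    unfolding projective_def using h(1) by blast
qed

end

theorem theorem1p5:
  fixes A :: "(real ^ 'l) set set"
    and \<alpha> :: "(real ^ 'l) set \<Rightarrow> real ^ 'l \<Rightarrow> real"
    and m :: nat
  assumes "central_arrangement A"
    and "defining_forms A \<alpha>"
    and "A \<noteq> {}"
    and "\<not> decomposable A"
    and "m \<ge> 1"
  shows "(card A = 1 \<longrightarrow>
            admissible_maps A \<alpha> m =
              {\<Phi> \<in> chamber_maps A m. \<forall>C\<in>chambers A. \<Phi> (const_tuple m C) = C})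
       \<and> (card A \<ge> 3 \<longrightarrow>
            (\<forall>\<Phi>\<in>admissible_maps A \<alpha> m. projective A m \<Phi>))"
proof -
  interpret arrangement A \<alpha>
    by standard fact+
  have "admissible_maps A \<alpha> m =
      {\<Phi> \<in> chamber_maps A m. \<forall>C\<in>chambers A. \<Phi> (const_tuple m C) = C}" if one: "card A = 1"
  proof -
    obtain H where "A = {H}"
      using one by (rule card_1_singletonE)
    moreover have "\<Phi> \<in> chamber_maps A m" if "\<Phi> \<in> admissible_maps A \<alpha> m" for \<Phi>
      using that by (simp add: admissible_maps_def)
    ultimately show ?thesis
      using singleton_admissible_map[of H _ m]
      by (intro set_eqI iffI) (simp_all add: admissible_map_diagonal)
  qed
  then show ?thesis
    using indecomposable_admissible_projective assms(4) by blast
qed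

end
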